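(* Assume that $H$ is convex (i.e. each $h_i$ is convex). Let $\{x^k\}$ be the sequence generated by the parameter-free generalized conditional gradient algorithm (FGM-CondG) described in the context. Assume that there exists $x^*\in\mathrm{dom}(G)$ such that $F(x^* )\preceq F(x^k)$ for all $k$, and put $\delta_k(x^* )=\min_{1\le i\le m}\{f_i(x^k)-f_i(x^* )\}$. Let $$A=(2M_\nu)^{\frac1\nu}D^{\frac{1+\nu}{\nu}},\quad \tilde k_0=\left\lceil\left(\log_2\frac{L_{-1}}{\tilde L_0}\right)_+\right\rceil,\quad k_0=\left\lceil4\left(\log\frac{4\,\delta_{\tilde k_0}(x^* )}{A^\nu}\right)_+\right\rceil,$$ $$\varGamma_k=\left((\delta_{k_0+\tilde k_0}(x^* ))^{-\frac1\nu}+\frac{k-k_0}{4A\nu}\right)^{-\nu}.$$ Then $\delta_k(x^* )\le\varGamma_{k-\tilde k_0}$ for all $k\ge k_0+\tilde k_0$. Furthermore, $$\min_{0\le j\le k}|\theta(x^j)|\le\exp(1/\exp(1))\;\varGamma_{\left\lfloor\frac{k-\tilde k_0+k_0+1}{2}\right\rfloor}$$ for all $k\ge k_0+\tilde k_0+\dfrac{8A}{(\delta_{k_0+\tilde k_0}(x^* ))^{1/\nu}}$.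
   Context: Let $m,n\ge 1$. For each $i\in\{1,\dots,m\}$ let $g_i:\mathbb{R}^n\to\mathbb{R}\cup\{+\infty\}$ be proper, convex and lower semicontinuous, let $h_i:\mathbb{R}^n\to\mathbb{R}$ be continuously differentiable, and set $f_i=g_i+h_i$, $F=(f_1,\dots,f_m)^\top$, $G=(g_1,\dots,g_m)^\top$, $H=(h_1,\dots,h_m)^\top$. Put $\mathrm{dom}(g_i)=\{x: g_i(x)<+\infty\}$ and $\mathrm{dom}(G)=\bigcap_i\mathrm{dom}(g_i)$; $\mathrm{dom}(G)$ is assumed nonempty, convex and compact, with diameter $D=\sup_{x,y\in\mathrm{dom}(G)}\|x-y\|$ ($\|\cdot\|$ the Euclidean norm). Hölder assumption: there are $\nu\in(0,1]$ and $M_{i,\nu}>0$ with $\|\nabla h_i(x)-\nabla h_i(y)\|\le M_{i,\nu}\|x-y\|^\nu$ for all $x,y\in\mathrm{dom}(g_i)$, $i=1,\dots,m$; set $M_\nu=\max_i M_{i,\nu}$. For $u,v\in\mathbb{R}^m$, $u\preceq v$ means $u_i\le v_i$ for all $i$; $e=(1,\dots,1)^\top\in\mathbb{R}^m$; $\varrho_+=\max\{\varrho,0\}$; $\log$ is the natural logarithm. For $x\in\mathrm{dom}(G)$ the gap function is $\theta(x)=\min_{u\in\mathbb{R}^n}\max_{1\le i\le m}\{g_i(u)-g_i(x)+\langle\nabla h_i(x),u-x\rangle\}$ (so $\theta(x)\le0$), and $s(x)\in\mathrm{dom}(G)$ denotes a chosen minimizer. Algorithm FGM-CondG: start from $x^0\in\mathrm{dom}(G)$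 and $L_{-1}>0$. At iteration $k=0,1,\dots$ compute $s(x^k)$ and $\theta(x^k)$; stop if $\theta(x^k)=0$. Otherwise, for $\ell=0,1,\dots$ set $$L_k^\ell=2^{\ell-1}L_{k-1},\quad t_k^\ell=\min\left\{1,\frac{|\theta(x^k)|}{2L_k^\ell\|s(x^k)-x^k\|^2}\right\},\quad x^{k+1}_\ell=x^k+t_k^\ell(s(x^k)-x^k),$$ until (at the first such $\ell$) $$F(x^{k+1}_\ell)\preceq F(x^k)+\left(-\tfrac12t_k^\ell|\theta(x^k)|+\tfrac12L_k^\ell(t_k^\ell)^2\|s(x^k)-x^k\|^2\right)e,$$ and for this $\ell$ put $x^{k+1}=x^{k+1}_\ell$, $L_k=L_k^\ell$, $t_k=t_k^\ell$. The generated sequence is understood to be infinite, i.e. $\theta(x^k)\neq0$ for all $k$ (then $s(x^k)\ne x^k$). For $\varepsilon>0$ let $L(\varepsilon)=\left(\frac{1-\nu}{1+\nu}\cdot\frac1{2\varepsilon}\right)^{\frac{1-\nu}{1+\nu}}M_\nu^{\frac{2}{1+\nu}}$ (with $0^0=1$, so $L(\varepsilon)=M_1$ if $\nu=1$), and $$\tilde L_k=\max\left\{L\left(\frac{|\theta(x^k)|}{2}\right),\left[L\left(\frac{|\theta(x^k)|^2}{4\|s(x^k)-x^k\|^2}\right)\right]^{\frac{1+\nu}{2\nu}}\right\}.$$ *)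

theory Defs
  imports "HOL-Analysis.Analysis"
begin

text \<open>
  Extended-real-valued functions \<open>\<real>\<^sup>n \<rightarrow> \<real> \<union> {+\<infinity>}\<close> are represented in \<^typ>\<open>ereal\<close>; the value
  \<open>-\<infinity>\<close> is excluded by \<open>proper_fun\<close>. For such functions the inequality in \<open>convex_fun\<close>
  never involves \<open>\<infinity> - \<infinity>\<close>, and \<open>0 * \<infinity> = 0\<close> makes the end points harmless.
\<close>

definition dom_fun :: "('a \<Rightarrow> ereal) \<Rightarrow> 'a set" where
  "dom_fun f = {x. f x < \<infinity>}"

definition proper_fun :: "('a \<Rightarrow> ereal) \<Rightarrow> bool" where
  "proper_fun f \<longleftrightarrow> (\<forall>x. f x \<noteq> -\<infinity>) \<and> dom_fun f \<noteq> {}"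

definition convex_fun :: "('a::real_vector \<Rightarrow> ereal) \<Rightarrow> bool" where
  "convex_fun f \<longleftrightarrow>
     (\<forall>x y. \<forall>u\<ge>0. \<forall>v\<ge>0. u + v = 1 \<longrightarrow>
        f (u *\<^sub>R x + v *\<^sub>R y) \<le> ereal u * f x + ereal v * f y)"

definition lsc_fun :: "('a::topological_space \<Rightarrow> ereal) \<Rightarrow> bool" where
  "lsc_fun f \<longleftrightarrow> (\<forall>x. f x \<le> Liminf (at x) f)"

definition dom_all :: "('m \<Rightarrow> 'a \<Rightarrow> ereal) \<Rightarrow> 'a set" where
  "dom_all g = (\<Inter>i. dom_fun (g i))"

definition composite_obj ::
  "('m \<Rightarrow> 'a \<Rightarrow> ereal) \<Rightarrow> ('m \<Rightarrow> 'a \<Rightarrow> real) \<Rightarrow> 'm \<Rightarrow> 'a \<Rightarrow> ereal" where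
  "composite_obj g h i x = g i x + ereal (h i x)"

text \<open>
  In the following, \<open>dh i x\<close> is the gradient of the smooth part \<open>h i\<close> at \<open>x\<close>, and \<open>s x\<close> is a
  minimizer of \<open>gap_obj g dh x\<close>.
\<close>

definition gap_obj ::
  "('m::finite \<Rightarrow> 'a::real_inner \<Rightarrow> ereal) \<Rightarrow> ('m \<Rightarrow> 'a \<Rightarrow> 'a) \<Rightarrow> 'a \<Rightarrow> 'a \<Rightarrow> ereal" where
  "gap_obj g dh x u = Max (range (\<lambda>i. g i u - g i x + ereal (dh i x \<bullet> (u - x))))"

text \<open>For \<open>x\<close> in \<open>dom_all g\<close> the infimum is a finite real number attained at \<open>s x\<close>.\<close>

definition gap ::
  "('m::finite \<Rightarrow> 'a::real_inner \<Rightarrow> ereal) \<Rightarrow> ('m \<Rightarrow> 'a \<Rightarrow> 'a) \<Rightarrow> 'a \<Rightarrow> real" where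
  "gap g dh x = real_of_ereal (INF u. gap_obj g dh x u)"

definition trial_const :: "real \<Rightarrow> nat \<Rightarrow> real" where
  "trial_const Lprev l = 2 powi (int l - 1) * Lprev"

definition trial_step ::
  "('m::finite \<Rightarrow> 'a::real_inner \<Rightarrow> ereal) \<Rightarrow> ('m \<Rightarrow> 'a \<Rightarrow> 'a) \<Rightarrow> ('a \<Rightarrow> 'a) \<Rightarrow> 'a \<Rightarrow> real \<Rightarrow> real" where
  "trial_step g dh s x L = min 1 (\<bar>gap g dh x\<bar> / (2 * L * (norm (s x - x))\<^sup>2))"

definition trial_point ::
  "('m::finite \<Rightarrow> 'a::real_inner \<Rightarrow> ereal) \<Rightarrow> ('m \<Rightarrow> 'a \<Rightarrow> 'a) \<Rightarrow> ('a \<Rightarrow> 'a) \<Rightarrow> 'a \<Rightarrow> real \<Rightarrow> 'a" where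
  "trial_point g dh s x L = x + trial_step g dh s x L *\<^sub>R (s x - x)"

definition trial_accepted ::
  "('m::finite \<Rightarrow> 'a::real_inner \<Rightarrow> ereal) \<Rightarrow> ('m \<Rightarrow> 'a \<Rightarrow> real) \<Rightarrow> ('m \<Rightarrow> 'a \<Rightarrow> 'a) \<Rightarrow> ('a \<Rightarrow> 'a)
     \<Rightarrow> 'a \<Rightarrow> real \<Rightarrow> bool" where
  "trial_accepted g h dh s x L \<longleftrightarrow>
     (let t = trial_step g dh s x L in
      \<forall>i. composite_obj g h i (trial_point g dh s x L)
           \<le> composite_obj g h i x
              + ereal (- (1/2) * t * \<bar>gap g dh x\<bar> + (1/2) * L * t\<^sup>2 * (norm (s x - x))\<^sup>2))"

text \<open>
  The state before iteration \<open>k\<close> is the pair of the iterate \<open>x\<^sup>k\<close> and the constant \<open>L\<^sub>k\<^sub>-\<^sub>1\<close>.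
  The recursion does not include the stopping test; it describes the algorithm as long as the
  gap does not vanish. The first accepted index is a \<open>LEAST\<close>, so termination of the
  backtracking loop is not built into the definition; it has to follow from the assumptions
  on the problem.
\<close>

primrec condg_state ::
  "('m::finite \<Rightarrow> 'a::real_inner \<Rightarrow> ereal) \<Rightarrow> ('m \<Rightarrow> 'a \<Rightarrow> real) \<Rightarrow> ('m \<Rightarrow> 'a \<Rightarrow> 'a) \<Rightarrow> ('a \<Rightarrow> 'a)
     \<Rightarrow> 'a \<Rightarrow> real \<Rightarrow> nat \<Rightarrow> 'a \<times> real" where
  "condg_state g h dh s x0 Linit 0 = (x0, Linit)"
| "condg_state g h dh s x0 Linit (Suc k) =
     (let x = fst (condg_state g h dh s x0 Linit k);
          Lprev = snd (condg_state g h dh s x0 Linit k);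
          l = (LEAST l. trial_accepted g h dh s x (trial_const Lprev l));
          L = trial_const Lprev l
      in (trial_point g dh s x L, L))"

definition condg_iterate ::
  "('m::finite \<Rightarrow> 'a::real_inner \<Rightarrow> ereal) \<Rightarrow> ('m \<Rightarrow> 'a \<Rightarrow> real) \<Rightarrow> ('m \<Rightarrow> 'a \<Rightarrow> 'a) \<Rightarrow> ('a \<Rightarrow> 'a)
     \<Rightarrow> 'a \<Rightarrow> real \<Rightarrow> nat \<Rightarrow> 'a" where
  "condg_iterate g h dh s x0 Linit k = fst (condg_state g h dh s x0 Linit k)"

text \<open>The case \<open>\<nu> = 1\<close> is separate because \<open>0 powr 0 = 0\<close>, while here \<open>0\<^sup>0 = 1\<close> is meant.\<close>

definition holder_L :: "real \<Rightarrow> real \<Rightarrow> real \<Rightarrow> real" where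
  "holder_L \<nu> M \<epsilon> =
     (if \<nu> = 1 then 1
      else ((1 - \<nu>) / (1 + \<nu>) * (1 / (2 * \<epsilon>))) powr ((1 - \<nu>) / (1 + \<nu>)))
     * M powr (2 / (1 + \<nu>))"

definition L_tilde ::
  "('m::finite \<Rightarrow> 'a::real_inner \<Rightarrow> ereal) \<Rightarrow> ('m \<Rightarrow> 'a \<Rightarrow> 'a) \<Rightarrow> ('a \<Rightarrow> 'a)
     \<Rightarrow> real \<Rightarrow> real \<Rightarrow> 'a \<Rightarrow> real" where
  "L_tilde g dh s \<nu> M x =
     max (holder_L \<nu> M (\<bar>gap g dh x\<bar> / 2))
         (holder_L \<nu> M (\<bar>gap g dh x\<bar>\<^sup>2 / (4 * (norm (s x - x))\<^sup>2)) powr ((1 + \<nu>) / (2 * \<nu>)))"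

definition min_excess ::
  "('m::finite \<Rightarrow> 'a \<Rightarrow> ereal) \<Rightarrow> ('m \<Rightarrow> 'a \<Rightarrow> real) \<Rightarrow> 'a \<Rightarrow> 'a \<Rightarrow> real" where
  "min_excess g h xs x =
     real_of_ereal (Min (range (\<lambda>i. composite_obj g h i x - composite_obj g h i xs)))"

end

theory Submission
  imports Defs
begin

text \<open>
  Write \<open>v\<^sub>k = \<bar>\<theta>(x\<^sup>k)\<bar>\<close>, \<open>d\<^sub>k = \<parallel>s(x\<^sup>k) - x\<^sup>k\<parallel>\<close>, \<open>K = 2 M D\<^sup>1\<^sup>+\<^sup>\<nu> = A\<^sup>\<nu>\<close>. Convexity of the \<open>h\<^sub>i\<close> gives
  \<open>\<delta>\<^sub>k \<le> v\<^sub>k\<close>, and the acceptance test gives \<open>\<delta>\<^sub>k\<^sub>+\<^sub>1 \<le> \<delta>\<^sub>k - t\<^sub>k v\<^sub>k / 4\<close>. So everything rests on the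
  lower bound \<open>t\<^sub>k \<ge> min 1 ((w/K)\<^sup>1\<^sup>/\<^sup>\<nu>)\<close> for any \<open>0 < w \<le> v\<^sub>0, \<dots>, v\<^sub>k\<close>, i.e. on an upper bound of \<open>L\<^sub>k\<close>.
  The general estimate \<open>L\<^sub>k \<le> 2 L\<close>-tilde loses a factor up to 2 when \<open>\<nu>\<close> is close to 1, so
  the bound is taken from the last rejected trial constant itself: a rejection at \<open>L\<close> means
  \<open>t v/2 + L (t d)\<^sup>2/2 < M/(1+\<nu>) (t d)\<^sup>1\<^sup>+\<^sup>\<nu>\<close>, where the first term is worth another \<open>L (t d)\<^sup>2\<close>
  if \<open>t < 1\<close>. If no trial was rejected up to step \<open>k\<close>, then \<open>L\<^sub>k = L\<^sub>-\<^sub>1 / 2\<^sup>k\<^sup>+\<^sup>1\<close>, which \<open>L\<close>-tilde at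
  \<open>x\<^sup>0\<close> controls for \<open>k\<close> from \<open>k\<close>-tilde on. With \<open>w = \<delta>\<^sub>k\<close> the excess first shrinks by factors 3/4 until it
  is below \<open>K\<close> and afterwards \<open>\<delta>\<^sub>k powr (-1/\<nu>)\<close> grows by \<open>1/(4 A \<nu>)\<close> per step; with \<open>w\<close> the
  smallest gap so far, summing the decrease over the last half of the steps bounds \<open>w\<close>.
\<close>

section \<open>Scalar estimates for the backtracking constant\<close>

text \<open>Weighted AM-GM for the numbers 2 and 1 with weights \<open>y\<close> and
  \<open>1 - y\<close>.\<close>

lemma two_powr_le: assumes "0 \<le> y" "y \<le> (1::real)" shows "2 powr y \<le> 1 + y"
  using Youngs_inequality_0[of y "1-y" 2 1] assms by auto

text \<open>The factor 4 anticipates the doubling: when \<open>2 * L\<close> is accepted after the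
  rejection of \<open>L\<close>, the right-hand side is
  \<open>w / (2 * (2 * L) * D\<^sup>2)\<close>, a lower bound for the accepted step before it is
  capped at 1. The proof treats trial steps below 1 and equal to 1 separately.\<close>

lemma rejected_const_bound:
  fixes \<nu> M v w d D L t K :: real
  assumes nu: "0 < \<nu>" "\<nu> \<le> 1" and pos: "0 < M" "0 < w" "0 < d" "0 < L"
    and le: "w \<le> v" "d \<le> D"
    and t: "t = min 1 (v / (2 * L * d\<^sup>2))"
    and rejected: "t * v / 2 + L * (t * d)\<^sup>2 / 2 < M / (1 + \<nu>) * (t * d) powr (1 + \<nu>)"
  defines "K \<equiv> 2 * M * D powr (1 + \<nu>)"
  shows "min 1 ((w / K) powr (1 / \<nu>)) \<le> w / (4 * L * D\<^sup>2)"
proof -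
  have D: "0 < D" using pos le by linarith
  have v: "0 < v" using pos le by linarith
  have K: "0 < K" using D pos unfolding K_def by simp
  show ?thesis
  proof (cases "v < 2 * L * d\<^sup>2")
    case True
    then have t': "t = v / (2 * L * d\<^sup>2)" using t pos by (simp add: min_def)
    define r where "r = t * d"
    have r: "r = v / (2 * L * d)" unfolding r_def t' using pos by (simp add: power2_eq_square)
    have rpos: "0 < r" using r pos v by simp
    have "t * v = 2 * L * r\<^sup>2" unfolding r t' using pos by (simp add: power2_eq_square field_simps)
    then have "3/2 * L * r\<^sup>2 < M / (1 + \<nu>) * r powr (1 + \<nu>)"
      using rejected unfolding r_def[symmetric] by simp
    also have "r\<^sup>2 = r powr (1 + \<nu>) * r powr (1 - \<nu>)"
      using rpos by (simp flip: powr_add)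
    finally have "(3/2 * L * r powr (1 - \<nu>)) * r powr (1 + \<nu>) < M / (1 + \<nu>) * r powr (1 + \<nu>)"
      by (simp add: mult_ac)
    then have 1: "3/2 * L * r powr (1 - \<nu>) < M / (1 + \<nu>)"
      using rpos by (subst (asm) mult_less_cancel_right_pos) auto
    \<comment> \<open>\<open>y\<close> is \<open>r\<close> with \<open>v\<close> and
      \<open>d\<close> replaced by \<open>w\<close> and \<open>D\<close>; since
      \<open>1 - \<nu>\<close> is nonnegative, this only lowers the power on the left of the
      inequality.\<close>
    define y where "y = w / (2 * L * D)"
    have ypos: "0 < y" using pos D by (simp add: y_def)
    have "y \<le> r" unfolding y_def r using pos le D by (intro frac_le) auto
    then have "y powr (1 - \<nu>) \<le> r powr (1 - \<nu>)" using nu ypos by (intro powr_mono2) auto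
    then have "3/2 * L * y powr (1 - \<nu>) \<le> 3/2 * L * r powr (1 - \<nu>)" using pos by simp
    with 1 have "3/2 * (L * y powr (1 - \<nu>)) < M / (1 + \<nu>)" by linarith
    then have 2: "(1 + \<nu>) * (3/2 * (L * y powr (1 - \<nu>))) < M"
      using nu by (subst (asm) pos_less_divide_eq) (auto simp: mult_ac)
    \<comment> \<open>The factor \<open>2 powr \<nu>\<close> supplies the 2 in
      \<open>y / (2 * D)\<close>, whose power with exponent \<open>\<nu>\<close> will dominate
      \<open>w / K\<close>.\<close>
    have "2 powr \<nu> * (L * y powr (1 - \<nu>)) \<le> ((1 + \<nu>) * (3/2)) * (L * y powr (1 - \<nu>))"
      using two_powr_le[of \<nu>] nu pos by (intro mult_right_mono) auto
    also have "\<dots> = (1 + \<nu>) * (3/2 * (L * y powr (1 - \<nu>)))" by (simp only: mult.assoc)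
    finally have 3: "2 powr \<nu> * (L * y powr (1 - \<nu>)) < M" using 2 by linarith
    have "w / K = y * L / (M * D powr \<nu>)"
      using pos D by (simp add: K_def y_def powr_add)
    also have "\<dots> = L * y powr (1 - \<nu>) * y powr \<nu> / (M * D powr \<nu>)"
      using ypos by (simp flip: powr_add add: mult.assoc mult.commute)
    also have "\<dots> \<le> (M / 2 powr \<nu>) * y powr \<nu> / (M * D powr \<nu>)"
      using 3 pos by (intro divide_right_mono mult_right_mono) (auto simp: field_simps)
    also have "\<dots> = (y / (2 * D)) powr \<nu>"
      using pos ypos D by (simp add: powr_divide powr_mult)
    finally have "(w / K) powr (1 / \<nu>) \<le> ((y / (2 * D)) powr \<nu>) powr (1 / \<nu>)"
      using nu pos K by (intro powr_mono2) auto
    also have "\<dots> = y / (2 * D)" using nu ypos D by (simp add: powr_powr)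
    also have "\<dots> = w / (4 * L * D\<^sup>2)" by (simp add: y_def power2_eq_square)
    finally show ?thesis by simp
  next
    case False
    then have "v / (2 * L * d\<^sup>2) \<ge> 1" using pos by (simp add: field_simps)
    then have t': "t = 1" using t by (simp add: min_def)
    \<comment> \<open>This exponent turns \<open>d powr (1 + \<nu>)\<close> into
      \<open>d\<^sup>2\<close>, so that \<open>d\<close> cancels later;
      \<open>p \<le> 1 / \<nu>\<close> allows the final change of exponent.\<close>
    define p where "p = 2 / (1 + \<nu>)"
    have p: "1 \<le> p" "p \<le> 2" "(1 + \<nu>) * p = 2" "p \<le> 1 / \<nu>"
      using nu by (auto simp: p_def field_simps)
    have sq: "(c powr (1 + \<nu>)) powr p = c\<^sup>2" if "0 < c" for c :: real
      using that p by (simp add: powr_powr)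
    \<comment> \<open>The bounds on \<open>L d\<^sup>2\<close> from \<open>t = 1\<close> and from the rejection (\<open>c1\<close> and \<open>c2\<close> below) meet at \<open>z = 1\<close>.\<close>
    define z where "z = 4 * (M / (1 + \<nu>)) * d powr (1 + \<nu>) / (3 * v)"
    have z: "0 < z" using pos nu v by (simp add: z_def)
    have mz: "M / (1 + \<nu>) * d powr (1 + \<nu>) = 3/4 * v * z" using v by (simp add: z_def)
    have c1: "L * d\<^sup>2 \<le> v * (1/2)" using False by simp
    have c2: "L * d\<^sup>2 < v * (3/2 * z - 1)" 
      using rejected unfolding t' mult_1 mz by (simp add: algebra_simps)
    \<comment> \<open>One power of \<open>z\<close> covers both bounds: it lies above
      \<open>3 * z - 2\<close> to the left of 1 and above 1 to the right of it.\<close>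
    have "L * d\<^sup>2 \<le> v * (z powr p / 2)"
    proof (cases "z \<le> 1")
      case True
      have "3 * z - 2 \<le> z\<^sup>2" using mult_nonneg_nonneg[of "1-z" "2-z"] True
        by (simp add: algebra_simps power2_eq_square)
      also have "\<dots> = z powr 2" using z by simp
      also have "\<dots> \<le> z powr p" using z True p by (intro powr_mono') auto
      finally have "v * (3/2 * z - 1) \<le> v * (z powr p / 2)" using v by simp
      with c2 show ?thesis by linarith
    next
      case False
      then have "1 \<le> z powr p" using p by (intro ge_one_powr_ge_zero) auto
      then have "v * (1/2) \<le> v * (z powr p / 2)" using v by simp
      with c1 show ?thesis by linarith
    qed
    moreover have "2 * z powr p \<le> (2 * M / v * d powr (1 + \<nu>)) powr p"
    proof -
      \<comment> \<open>The number \<open>3/2 * (1 + \<nu>)\<close> is exactly the ratio of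
        \<open>2 * M / v * d powr (1 + \<nu>)\<close> to \<open>z\<close>, and its
        \<open>p\<close>-th power is large enough to absorb the factor 2.\<close>
      have "2 powr (1/p) \<le> 3/2 * (1 + \<nu>)"
        using two_powr_le[of "1/p"] nu by (simp add: p_def field_simps)
      then have "(2 powr (1/p)) powr p \<le> (3/2 * (1 + \<nu>)) powr p" using p by (intro powr_mono2) auto
      then have "2 * z powr p \<le> (3/2 * (1 + \<nu>)) powr p * z powr p"
        using p by (intro mult_right_mono) (simp_all add: powr_powr)
      also have "\<dots> = (3/2 * (1 + \<nu>) * z) powr p" by (rule powr_mult[symmetric])
      also have "3/2 * (1 + \<nu>) * z = 2 * M / v * d powr (1 + \<nu>)"
      proof -
        have cancel: "3/2 * n * (4 * (M / n) * P / (3 * v)) = 2 * M / v * P" if "0 < n" for n P :: real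
          using that v by (simp add: field_simps)
        show ?thesis unfolding z_def by (rule cancel) (use nu in simp)
      qed
      finally show ?thesis .
    qed
    then have "v / 4 * (2 * z powr p) \<le> v / 4 * (2 * M / v * d powr (1 + \<nu>)) powr p"
      using v by (intro mult_left_mono) auto
    ultimately have "L * d\<^sup>2 \<le> v / 4 * (2 * M / v * d powr (1 + \<nu>)) powr p" by simp
    also have "\<dots> = v / 4 * (2 * M / v) powr p * d\<^sup>2"
      using sq[of d] pos by (simp only: powr_mult mult.assoc)
    finally have "L \<le> v / 4 * (2 * M / v) powr p" using pos by simp
    also have "\<dots> = (2 * M) powr p * v powr (1 - p) / 4"
      using v by (simp add: powr_divide powr_diff mult.commute)
    \<comment> \<open>The exponent \<open>1 - p\<close> is nonpositive, so passing from
      \<open>v\<close> down to \<open>w\<close> enlarges the bound.\<close>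
    also have "\<dots> \<le> (2 * M) powr p * w powr (1 - p) / 4"
      using p pos le by (intro divide_right_mono mult_left_mono powr_mono2') auto
    also have "\<dots> = w / 4 * (2 * M / w) powr p"
      using pos by (simp add: powr_divide powr_diff mult.commute)
    finally have "L * D\<^sup>2 * 4 * (w / K) powr p \<le> w / 4 * (2 * M / w) powr p * D\<^sup>2 * 4 * (w / K) powr p"
      by (intro mult_right_mono) auto
    also have "\<dots> = w * ((2 * M / w) * D powr (1 + \<nu>) * (w / K)) powr p"
      unfolding powr_mult sq[OF D] by simp
    also have "(2 * M / w) * D powr (1 + \<nu>) * (w / K) = 1"
      using pos D by (simp add: K_def)
    finally have "(w / K) powr p \<le> w / (4 * L * D\<^sup>2)" using pos D by (simp add: field_simps)
    moreover have "min 1 ((w / K) powr (1 / \<nu>)) \<le> (w / K) powr p"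
    proof (cases "w / K \<le> 1")
      case True
      then have "(w / K) powr (1 / \<nu>) \<le> (w / K) powr p" using p pos K by (intro powr_mono') auto
      then show ?thesis by simp
    next
      case False
      then have "1 \<le> (w / K) powr p" using p by (intro ge_one_powr_ge_zero) auto
      then show ?thesis by simp
    qed
    ultimately show ?thesis by linarith
  qed
qed

lemma holder_L_pos: "0 < \<nu> \<Longrightarrow> \<nu> \<le> 1 \<Longrightarrow> 0 < M \<Longrightarrow> 0 < e \<Longrightarrow> 0 < holder_L \<nu> M e"
  by (auto simp: holder_L_def)

text \<open>Counterpart of the rejection bound for a run whose trials were all accepted at once: a
  constant of at most half the maximum below still satisfies the same step estimate. The two members
  of the maximum are bounded separately, the first with exponent \<open>2 / (1 + \<nu>)\<close> and
  the second with \<open>1 / \<nu>\<close>.\<close>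

lemma L_tilde_bound:
  fixes \<nu> M v w d D K :: real
  assumes nu: "0 < \<nu>" "\<nu> \<le> 1" and pos: "0 < M" "0 < w" "0 < d"
    and le: "w \<le> v" "d \<le> D"
  defines "K \<equiv> 2 * M * D powr (1 + \<nu>)"
  shows "min 1 ((w / K) powr (1 / \<nu>)) * (D\<^sup>2 *
           max (holder_L \<nu> M (v / 2)) (holder_L \<nu> M (v\<^sup>2 / (4 * d\<^sup>2)) powr ((1 + \<nu>) / (2 * \<nu>)))) \<le> w"
proof -
  have D: "0 < D" using pos le by linarith
  have v: "0 < v" using pos le by linarith
  have K: "0 < K" using D pos unfolding K_def by simp
  let ?m = "min 1 ((w / K) powr (1 / \<nu>))"
  have first: "?m * (D\<^sup>2 * holder_L \<nu> M (v / 2)) \<le> w"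
    and second: "?m * (D\<^sup>2 * holder_L \<nu> M (v\<^sup>2 / (4 * d\<^sup>2)) powr ((1 + \<nu>) / (2 * \<nu>))) \<le> w"
  proof -
    show "?m * (D\<^sup>2 * holder_L \<nu> M (v / 2)) \<le> w"
    proof (cases "\<nu> = 1")
      case True
      have "?m * (D\<^sup>2 * M) \<le> (w / K) * (D\<^sup>2 * M)"
        using True pos K by (intro mult_right_mono) auto
      also have "\<dots> \<le> w" using True pos D by (simp add: K_def)
      finally show ?thesis using True pos by (simp add: holder_L_def)
    next
      case False
      define p where "p = 2 / (1 + \<nu>)"
      have p: "1 < p" "p \<le> 2" "(1 + \<nu>) * p = 2" "p \<le> 1 / \<nu>" "p - 1 = (1 - \<nu>) / (1 + \<nu>)"
        using nu False by (auto simp: p_def field_simps)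
      have "holder_L \<nu> M (v / 2) = ((1 - \<nu>) / (1 + \<nu>) * (1 / v)) powr (p - 1) * M powr p"
        using False by (simp add: holder_L_def p(5)) (simp add: p_def)
      also have "\<dots> \<le> (1 / w) powr (p - 1) * M powr p"
      proof (intro mult_right_mono powr_mono2)
        have "(1 - \<nu>) / (1 + \<nu>) * (1 / v) \<le> 1 * (1 / w)"
          using nu pos le v by (intro mult_mono) (auto simp: field_simps)
        then show "(1 - \<nu>) / (1 + \<nu>) * (1 / v) \<le> 1 / w" by simp
      qed (use p nu v in auto)
      finally have "?m * (D\<^sup>2 * holder_L \<nu> M (v / 2)) \<le> ?m * (D\<^sup>2 * ((1 / w) powr (p - 1) * M powr p))"
        by (intro mult_left_mono) auto
      also have "\<dots> \<le> (w / K) powr p * (D\<^sup>2 * ((1 / w) powr (p - 1) * M powr p))"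
      proof (intro mult_right_mono)
        show "?m \<le> (w / K) powr p"
        proof (cases "w / K \<le> 1")
          case True
          then have "(w / K) powr (1 / \<nu>) \<le> (w / K) powr p" using p pos K by (intro powr_mono') auto
          then show ?thesis by simp
        next
          case False
          then have "1 \<le> (w / K) powr p" using p by (intro ge_one_powr_ge_zero) auto
          then show ?thesis by simp
        qed
      qed (use pos in auto)
      also have "\<dots> = w * (1 / 2) powr p"
      proof -
        have "(D powr (1 + \<nu>)) powr p = D\<^sup>2" using p D by (simp add: powr_powr)
        then show ?thesis using pos D
          by (simp add: K_def powr_mult powr_divide powr_diff)
      qed
      also have "\<dots> \<le> w * 1" using pos p by (intro mult_left_mono powr_le1) auto
      finally show ?thesis by simp
    qed
    show "?m * (D\<^sup>2 * holder_L \<nu> M (v\<^sup>2 / (4 * d\<^sup>2)) powr ((1 + \<nu>) / (2 * \<nu>))) \<le> w"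
    proof -
      \<comment> \<open>Raising to \<open>q\<close> gives \<open>M\<close> the exponent
        \<open>1 / \<nu>\<close> and the other factor of \<open>holder_L\<close> the exponent
        \<open>e\<close>, matching \<open>(w / K) powr (1 / \<nu>)\<close>.\<close>
      define q where "q = (1 + \<nu>) / (2 * \<nu>)"
      have cancel: "2 / n * (n / (2 * \<nu>)) = 1 / \<nu>" "(1 - \<nu>) / n * (n / (2 * \<nu>)) = (1 - \<nu>) / (2 * \<nu>)"
        if "n \<noteq> 0" for n using that by simp_all
      have "0 < q" using nu by (simp add: q_def)
      moreover have "2 / (1 + \<nu>) * q = 1 / \<nu>" "(1 - \<nu>) / (1 + \<nu>) * q = (1 - \<nu>) / (2 * \<nu>)"
        unfolding q_def by (rule cancel, use nu in simp)+
      moreover have "(1 - \<nu>) / (2 * \<nu>) = (1 / \<nu> - 1) / 2" using nu by (simp add: field_simps)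
      ultimately have q: "0 < q" "2 / (1 + \<nu>) * q = 1 / \<nu>" "(1 - \<nu>) / (1 + \<nu>) * q = (1 / \<nu> - 1) / 2"
        by simp_all
      define e where "e = (1 / \<nu> - 1) / 2"
      have e: "0 \<le> e" using nu by (simp add: e_def field_simps)
      have "holder_L \<nu> M (v\<^sup>2 / (4 * d\<^sup>2)) powr q \<le> (2 * D\<^sup>2 / w\<^sup>2) powr e * M powr (1 / \<nu>)"
      proof (cases "\<nu> = 1")
        case True
        then show ?thesis using pos D by (simp add: holder_L_def e_def q_def)
      next
        case False
        have arg: "1 / (2 * (v\<^sup>2 / (4 * d\<^sup>2))) = 2 * d\<^sup>2 / v\<^sup>2" by simp
        have "holder_L \<nu> M (v\<^sup>2 / (4 * d\<^sup>2)) powr q =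
            ((1 - \<nu>) / (1 + \<nu>) * (2 * d\<^sup>2 / v\<^sup>2)) powr e * M powr (1 / \<nu>)"
          using False by (simp only: holder_L_def arg powr_mult powr_powr q e_def if_False)
        also have "\<dots> \<le> (2 * D\<^sup>2 / w\<^sup>2) powr e * M powr (1 / \<nu>)"
        proof (intro mult_right_mono powr_mono2)
          have "(1 - \<nu>) / (1 + \<nu>) * (2 * d\<^sup>2 / v\<^sup>2) \<le> 1 * (2 * D\<^sup>2 / w\<^sup>2)"
            using nu pos le v by (intro mult_mono frac_le power_mono) (auto simp: field_simps power_mono)
          then show "(1 - \<nu>) / (1 + \<nu>) * (2 * d\<^sup>2 / v\<^sup>2) \<le> 2 * D\<^sup>2 / w\<^sup>2" by simp
        qed (use nu e in auto)
        finally show ?thesis .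
      qed
      then have "?m * (D\<^sup>2 * holder_L \<nu> M (v\<^sup>2 / (4 * d\<^sup>2)) powr q)
          \<le> (w / K) powr (1 / \<nu>) * (D\<^sup>2 * ((2 * D\<^sup>2 / w\<^sup>2) powr e * M powr (1 / \<nu>)))"
        by (intro mult_mono mult_left_mono) auto
      also have "\<dots> = w * 2 powr (e - 1 / \<nu>)"
      proof -
        \<comment> \<open>Logarithms reduce the claim to counting exponents: \<open>D\<close> and
          \<open>M\<close> cancel, and \<open>w\<close> keeps
          \<open>1 / \<nu> - 2 * e = 1\<close>.\<close>
        have "ln ((w / K) powr (1 / \<nu>) * (D\<^sup>2 * ((2 * D\<^sup>2 / w\<^sup>2) powr e * M powr (1 / \<nu>))))
            = ln (w * 2 powr (e - 1 / \<nu>))"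
          using pos D K nu by (simp add: K_def ln_mult ln_div ln_powr ln_realpow e_def field_simps)
        then show ?thesis using pos D K by (subst (asm) ln_inj_iff) auto
      qed
      also have "\<dots> \<le> w * 2 powr 0"
      proof (intro mult_left_mono powr_mono)
        have "(a - 1) / 2 - a \<le> 0" if "0 < a" for a :: real using that by simp
        from this[of "1 / \<nu>"] show "e - 1 / \<nu> \<le> 0" using nu by (simp only: e_def) simp
      qed (use pos in auto)
      finally show ?thesis by (simp add: q_def)
    qed
  qed
  then show ?thesis by (simp add: max_def)
qed

section \<open>The scalar recursion and its sublinear rate\<close>

text \<open>Combines the tangent bounds \<open>ln (1 - \<beta>) \<le> - \<beta>\<close> and
  \<open>1 + u \<le> exp u\<close>.\<close>

lemma bernoulli_powr_neg:
  fixes \<beta> a :: real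
  assumes "0 \<le> a" "\<beta> < 1"
  shows "1 + a * \<beta> \<le> (1 - \<beta>) powr (- a)"
proof -
  have "ln (1 - \<beta>) \<le> - \<beta>" using ln_le_minus_one[of "1 - \<beta>"] assms by simp
  then have "a * \<beta> \<le> a * (- ln (1 - \<beta>))" using assms by (intro mult_left_mono) auto
  then have "1 + a * \<beta> \<le> 1 + a * (- ln (1 - \<beta>))" by simp
  also have "\<dots> \<le> exp (a * (- ln (1 - \<beta>)))" by (rule exp_ge_add_one_self)
  also have "\<dots> = (1 - \<beta>) powr (- a)" using assms by (simp add: powr_def)
  finally show ?thesis .
qed

text \<open>The maximum is at \<open>p = exp 1\<close>, so the tangent of \<open>ln\<close> is taken
  there. This is the source of the constant in the rate for the gap.\<close>

lemma powr_inverse_self_le: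
  fixes p :: real
  assumes "0 < p"
  shows "p powr (1 / p) \<le> exp (1 / exp 1)"
proof -
  have "ln (p / exp 1) \<le> p / exp 1 - 1" using assms by (intro ln_le_minus_one) simp
  then have "ln p \<le> p / exp 1" using assms by (simp add: ln_div)
  then have "ln p / p \<le> 1 / exp 1" using assms by (simp add: field_simps)
  then show ?thesis using assms by (simp add: powr_def)
qed

text \<open>Free of the optimization problem: \<open>\<delta>\<close> stands for the excess,
  \<open>v\<close> for the gap. The hypothesis \<open>step\<close> leaves \<open>w\<close> open
  because the two claims need different choices.\<close>

lemma sublinear_decrease:
  fixes \<delta> v :: "nat \<Rightarrow> real" and \<nu> A :: real and kt0 k0 :: nat
  assumes nu: "0 < \<nu>" and A: "0 < A"
    and \<delta>_pos: "\<And>k. 0 < \<delta> k" and \<delta>_dec: "\<And>k. \<delta> (Suc k) \<le> \<delta> k" and \<delta>_le: "\<And>k. \<delta> k \<le> v k"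
    and step: "\<And>k w. kt0 \<le> k \<Longrightarrow> 0 < w \<Longrightarrow> (\<And>j. j \<le> k \<Longrightarrow> w \<le> v j) \<Longrightarrow>
                 \<delta> (Suc k) \<le> \<delta> k - w / 4 * min 1 (w powr (1 / \<nu>) / A)"
    and k0: "k0 = nat \<lceil>4 * max 0 (ln (4 * \<delta> kt0 / A powr \<nu>))\<rceil>"
    and \<Gamma>: "\<And>k. \<Gamma> k = (\<delta> (k0 + kt0) powr (- (1 / \<nu>))
                          + (real k - real k0) / (4 * A * \<nu>)) powr (- \<nu>)"
  shows "\<And>k. k0 + kt0 \<le> k \<Longrightarrow> \<delta> k \<le> \<Gamma> (k - kt0)"
    and "\<And>k. real k \<ge> real k0 + real kt0 + 8 * A / \<delta> (k0 + kt0) powr (1 / \<nu>) \<Longrightarrow>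
            Min (v ` {0..k}) \<le> exp (1 / exp 1) * \<Gamma> (nat \<lfloor>(real k - real kt0 + real k0 + 1) / 2\<rfloor>)"
proof -
  have anti: "antimono \<delta>" using \<delta>_dec by (rule decseq_SucI)
  have v_pos: "0 < v k" for k using \<delta>_pos[of k] \<delta>_le[of k] by linarith
  have \<delta>_step: "\<delta> (Suc k) \<le> \<delta> k * (1 - min 1 (\<delta> k powr (1 / \<nu>) / A) / 4)" if "kt0 \<le> k" for k
  proof -
    have "\<delta> k \<le> v j" if "j \<le> k" for j
      using antimonoD[OF anti that] \<delta>_le[of j] by linarith
    from step[OF that \<delta>_pos this] show ?thesis by (simp add: algebra_simps)
  qed
  have ge1: "1 \<le> z powr (1 / \<nu>) / A" if "A powr \<nu> \<le> z" for z
  proof -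
    have "(A powr \<nu>) powr (1 / \<nu>) \<le> z powr (1 / \<nu>)" using that nu A by (intro powr_mono2) auto
    then show ?thesis using nu A by (simp add: powr_powr)
  qed
  have le1: "z powr (1 / \<nu>) / A \<le> 1" if "z \<le> A powr \<nu>" "0 < z" for z
  proof -
    have "z powr (1 / \<nu>) \<le> (A powr \<nu>) powr (1 / \<nu>)" using that nu A by (intro powr_mono2) auto
    then show ?thesis using nu A by (simp add: powr_powr)
  qed
  \<comment> \<open>Were the excess still above \<open>A powr \<nu>\<close>, each of the
    \<open>k0\<close> steps would have contracted it by 3/4, hence by \<open>exp (- (1/4))\<close>.
    The choice of \<open>k0\<close> then pushes it down to \<open>A powr \<nu> / 4\<close>, a
    contradiction.\<close>
  have small: "\<delta> (k0 + kt0) \<le> A powr \<nu>"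
  proof (rule ccontr)
    assume "\<not> ?thesis"
    then have big: "A powr \<nu> < \<delta> (n + kt0)" if "n \<le> k0" for n
      using antimonoD[OF anti, of "n + kt0" "k0 + kt0"] that by simp
    have "\<delta> (n + kt0) \<le> \<delta> kt0 * exp (- (real n / 4))" if "n \<le> k0" for n
      using that
    proof (induction n)
      case (Suc n)
      have "\<delta> (Suc n + kt0) \<le> \<delta> (n + kt0) * (1 - 1 / 4)"
        using \<delta>_step[of "n + kt0"] ge1[of "\<delta> (n + kt0)"] big[of n] Suc.prems by simp
      also have "\<dots> \<le> \<delta> (n + kt0) * exp (- (1 / 4))"
        using \<delta>_pos[of "n + kt0"] exp_ge_add_one_self[of "- (1/4) :: real"] by (intro mult_left_mono) auto
      also have "\<dots> \<le> \<delta> kt0 * exp (- (real n / 4)) * exp (- (1 / 4))"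
        using Suc by (intro mult_right_mono) auto
      also have "\<dots> = \<delta> kt0 * exp (- (real (Suc n) / 4))"
        by (simp add: mult.assoc add_divide_distrib flip: exp_add)
      finally show ?case .
    qed simp
    then have "\<delta> (k0 + kt0) \<le> \<delta> kt0 * exp (- (real k0 / 4))" by simp
    also have "\<dots> \<le> \<delta> kt0 * exp (- ln (4 * \<delta> kt0 / A powr \<nu>))"
    proof (intro mult_left_mono)
      have "4 * ln (4 * \<delta> kt0 / A powr \<nu>) \<le> real k0"
        unfolding k0 by linarith
      then show "exp (- (real k0 / 4)) \<le> exp (- ln (4 * \<delta> kt0 / A powr \<nu>))" by simp
    qed (use \<delta>_pos[of kt0] in simp)
    also have "\<dots> = A powr \<nu> / 4"
      using \<delta>_pos[of kt0] A by (simp add: exp_minus)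
    finally have "\<delta> (k0 + kt0) \<le> A powr \<nu> / 4" .
    moreover have "0 < A powr \<nu>" using A by simp
    ultimately show False using big[of k0] by linarith
  qed
  define a where "a = \<delta> (k0 + kt0) powr (- (1 / \<nu>))"
  have a: "0 < a" using \<delta>_pos[of "k0 + kt0"] by (simp add: a_def)
  have \<Gamma>': "\<Gamma> (n + k0) = (a + real n / (4 * A * \<nu>)) powr (- \<nu>)" for n
    by (simp add: \<Gamma> a_def)
  \<comment> \<open>Negative powers make the recursion additive: in the Bernoulli bound the factor
    \<open>\<delta> powr (1 / \<nu>)\<close> of the relative decrease \<open>?b\<close> cancels
    against \<open>\<delta> powr (- (1 / \<nu>))\<close>, which leaves a constant increment.\<close>
  have grow: "a + real n / (4 * A * \<nu>) \<le> \<delta> (n + k0 + kt0) powr (- (1 / \<nu>))" for n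
  proof (induction n)
    case (Suc n)
    let ?d = "\<delta> (n + k0 + kt0)"
    let ?b = "?d powr (1 / \<nu>) / A / 4"
    have d: "0 < ?d" by (rule \<delta>_pos)
    have dle: "?d \<le> A powr \<nu>" using antimonoD[OF anti, of "k0 + kt0" "n + k0 + kt0"] small by simp
    have b: "?b \<le> 1 / 4" using le1[OF dle d] by simp
    have "\<delta> (Suc n + k0 + kt0) \<le> ?d * (1 - ?b)"
      using \<delta>_step[of "n + k0 + kt0"] le1[OF dle d] by (simp add: min_def split: if_splits)
    then have "(?d * (1 - ?b)) powr (- (1 / \<nu>)) \<le> \<delta> (Suc n + k0 + kt0) powr (- (1 / \<nu>))"
      using nu \<delta>_pos by (intro powr_mono2') auto
    moreover have "?d powr (- (1 / \<nu>)) * (1 + 1 / \<nu> * ?b) \<le> ?d powr (- (1 / \<nu>)) * (1 - ?b) powr (- (1 / \<nu>))"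
      using nu b by (intro mult_left_mono bernoulli_powr_neg) auto
    moreover have "(?d * (1 - ?b)) powr (- (1 / \<nu>)) = ?d powr (- (1 / \<nu>)) * (1 - ?b) powr (- (1 / \<nu>))"
      by (rule powr_mult)
    moreover have "?d powr (- (1 / \<nu>)) * (1 + 1 / \<nu> * ?b) = ?d powr (- (1 / \<nu>)) + 1 / (4 * A * \<nu>)"
      using d nu A by (simp add: powr_minus field_simps)
    ultimately have "?d powr (- (1 / \<nu>)) + 1 / (4 * A * \<nu>) \<le> \<delta> (Suc n + k0 + kt0) powr (- (1 / \<nu>))"
      by linarith
    then show ?case using Suc.IH by (simp add: add_divide_distrib)
  qed (simp add: a_def)
  have main: "\<delta> (n + k0 + kt0) \<le> \<Gamma> (n + k0)" for n
  proof -
    have "(\<delta> (n + k0 + kt0) powr (- (1 / \<nu>))) powr (- \<nu>) \<le> \<Gamma> (n + k0)"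
      unfolding \<Gamma>' using grow[of n] a nu A by (intro powr_mono2') (auto intro!: add_pos_nonneg)
    then show ?thesis using nu \<delta>_pos[of "n + k0 + kt0"] by (simp add: powr_powr)
  qed
  show "\<delta> k \<le> \<Gamma> (k - kt0)" if "k0 + kt0 \<le> k" for k
    using main[of "k - kt0 - k0"] that by simp
  show "Min (v ` {0..k}) \<le> exp (1 / exp 1) * \<Gamma> (nat \<lfloor>(real k - real kt0 + real k0 + 1) / 2\<rfloor>)"
    if k: "real k \<ge> real k0 + real kt0 + 8 * A / \<delta> (k0 + kt0) powr (1 / \<nu>)" for k
  proof -
    let ?d0 = "\<delta> (k0 + kt0)"
    have d0: "0 < ?d0" by (rule \<delta>_pos)
    have a_eq: "a = 1 / ?d0 powr (1 / \<nu>)" by (simp add: a_def powr_minus_divide)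
    \<comment> \<open>With this, the assumption on \<open>k\<close> forces at least 8 steps after
      index \<open>k0 + kt0\<close>.\<close>
    have Aa: "1 \<le> A * a" using le1[OF small d0] A d0 by (simp add: a_eq field_simps)
    have kA: "real k \<ge> real k0 + real kt0 + 8 * (A * a)" using k by (simp add: a_eq)
    then have kk: "k0 + kt0 \<le> k" using Aa by linarith
    define N where "N = k - kt0 - k0"
    have N: "k = N + k0 + kt0" using kk by (simp add: N_def)
    have NA: "8 * (A * a) \<le> real N" using kA by (simp add: N)
    \<comment> \<open>Half of the \<open>N\<close> steps, rounded up; shifted by \<open>k0\<close>,
      it is the index of \<open>\<Gamma>\<close> in the claim.\<close>
    define n where "n = (N + 1) div 2"
    have n2: "N \<le> 2 * n" "2 * n \<le> N + 1" by (auto simp: n_def)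
    have idx: "nat \<lfloor>(real k - real kt0 + real k0 + 1) / 2\<rfloor> = n + k0"
    proof -
      have "(real k - real kt0 + real k0 + 1) / 2 = real (N + 1) / 2 + of_int (int k0)"
        by (simp add: N field_simps)
      then have "\<lfloor>(real k - real kt0 + real k0 + 1) / 2\<rfloor> = \<lfloor>real (N + 1) / real 2\<rfloor> + int k0"
        by (simp only: floor_add_int) simp
      also have "\<lfloor>real (N + 1) / real 2\<rfloor> = int n"
        unfolding n_def by (rule floor_divide_of_nat_eq)
      finally show ?thesis by simp
    qed
    have n4: "4 * (A * a) \<le> real n" using NA n2 by linarith
    define w where "w = Min (v ` {0..k})"
    have w: "0 < w" using v_pos by (simp add: w_def)
    have w_le: "w \<le> v j" if "j \<le> k" for j using that by (simp add: w_def)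
    define c where "c = w / 4 * min 1 (w powr (1 / \<nu>) / A)"
    have c: "0 < c" using w A by (simp add: c_def)
    have sum: "real i * c \<le> \<delta> (n + k0 + kt0) - \<delta> (n + k0 + kt0 + i)" if "n + k0 + kt0 + i \<le> Suc k" for i
      using that
    proof (induction i)
      case (Suc i)
      have "\<delta> (Suc (n + k0 + kt0 + i)) \<le> \<delta> (n + k0 + kt0 + i) - c"
        unfolding c_def using Suc.prems w by (intro step w_le) auto
      with Suc show ?case by (simp add: algebra_simps)
    qed simp
    \<comment> \<open>The \<open>n\<close> steps in the sum end at iterate \<open>k + 1\<close> at
      the latest, so each starts where the gap is still known to be at least
      \<open>w\<close>.\<close>
    have "n + k0 + kt0 + n \<le> Suc k" using n2 by (simp add: N)
    from sum[OF this] have "real n * c \<le> \<delta> (n + k0 + kt0)" using \<delta>_pos[of "n + k0 + kt0 + n"] by linarith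
    also have "\<dots> \<le> \<Gamma> (n + k0)" by (rule main)
    finally have nc: "real n * c \<le> \<Gamma> (n + k0)" .
    define G where "G = \<Gamma> (n + k0)"
    have npos: "0 < real n" using n4 Aa by linarith
    have base: "0 < a + real n / (4 * A * \<nu>)" using a nu A npos by (intro add_pos_pos) auto
    then have G: "0 < G" by (simp add: G_def \<Gamma>')
    have "w \<le> exp (1 / exp 1) * G"
    proof (cases "w powr (1 / \<nu>) / A \<le> 1")
      case False
      \<comment> \<open>The minimum in \<open>c\<close> equals 1 here, and \<open>n \<ge> 4\<close>
        already gives \<open>w \<le> G\<close>.\<close>
      then have "w = 4 * c" by (simp add: c_def)
      then have "real n * w \<le> 4 * G" using nc by (simp add: G_def)
      moreover have "4 * w \<le> real n * w" using n4 Aa w by (intro mult_right_mono) auto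
      ultimately have "w \<le> 1 * G" by simp
      also have "\<dots> \<le> exp (1 / exp 1) * G" using G by (intro mult_right_mono) auto
      finally show ?thesis .
    next
      case True
      define p where "p = 1 + 1 / \<nu>"
      have p: "0 < p" using nu by (simp add: p_def add_pos_pos)
      have c_eq: "c = w powr p / (4 * A)" using True w by (simp add: c_def p_def powr_add)
      have "w powr p \<le> (4 * A / real n) * G"
        using nc A npos unfolding c_eq G_def[symmetric] by (simp add: field_simps)
      \<comment> \<open>Here the lower bound on \<open>k\<close> enters:
        \<open>n \<ge> 4 * A * a\<close> makes \<open>a\<close> at most \<open>n / (4 * A)\<close>,
        so the base of \<open>G\<close> is at most \<open>p * n / (4 * A)\<close>.\<close>
      also have "4 * A / real n \<le> p * G powr (1 / \<nu>)"
      proof -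
        have "G powr (1 / \<nu>) = 1 / (a + real n / (4 * A * \<nu>))"
          using nu base unfolding G_def \<Gamma>' by (simp add: powr_powr powr_neg_one)
        moreover have "a + real n / (4 * A * \<nu>) \<le> p * (real n / (4 * A))"
          using n4 A nu by (simp add: p_def field_simps)
        then have "(4 * A / real n) * (a + real n / (4 * A * \<nu>)) \<le> (4 * A / real n) * (p * (real n / (4 * A)))"
          using A by (intro mult_left_mono) auto
        then have "(4 * A / real n) * (a + real n / (4 * A * \<nu>)) \<le> p" using A npos by simp
        ultimately show ?thesis using base by (simp add: pos_le_divide_eq)
      qed
      finally have "w powr p \<le> p * G powr (1 / \<nu>) * G" using G by (simp add: mult_right_mono)
      also have "\<dots> = p * G powr p" using G by (simp add: p_def powr_add)
      finally have "(w powr p) powr (1 / p) \<le> (p * G powr p) powr (1 / p)"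
        using p by (intro powr_mono2) auto
      then have "w \<le> p powr (1 / p) * G" using p w G by (simp add: powr_powr powr_mult)
      also have "\<dots> \<le> exp (1 / exp 1) * G" using G p by (intro mult_right_mono powr_inverse_self_le) auto
      finally show ?thesis .
    qed
    then show ?thesis by (simp add: w_def idx G_def)
  qed
qed

section \<open>First-order inequalities along a segment\<close>

lemma DERIV_along_line:
  fixes h :: "'a::real_inner \<Rightarrow> real"
  assumes "GDERIV h (x + \<tau> *\<^sub>R u) :> D"
  shows "((\<lambda>\<tau>. h (x + \<tau> *\<^sub>R u)) has_real_derivative (D \<bullet> u)) (at \<tau>)"
proof -
  have "((\<lambda>\<tau>. x + \<tau> *\<^sub>R u) has_derivative (\<lambda>k. k *\<^sub>R u)) (at \<tau>)"
    by (auto intro!: derivative_eq_intros)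
  from has_derivative_compose[OF this assms[unfolded gderiv_def]]
  show ?thesis by (simp add: has_field_derivative_def inner_commute mult.commute[of _ "D \<bullet> u"])
qed

text \<open>On the line through \<open>x\<close> and \<open>y\<close> the function is convex in one
  real variable; its tangent at parameter 0 is evaluated at 1.\<close>

lemma convex_gradient_inequality:
  fixes h :: "'a::real_inner \<Rightarrow> real"
  assumes conv: "convex_on UNIV h" and grad: "GDERIV h x :> D"
  shows "h x + D \<bullet> (y - x) \<le> h y"
proof -
  let ?\<phi> = "\<lambda>\<tau>. h (x + \<tau> *\<^sub>R (y - x))"
  have "convex_on UNIV ?\<phi>"
  proof (rule convex_onI)
    fix t a b :: real assume t: "0 < t" "t < 1"
    have "x + ((1 - t) *\<^sub>R a + t *\<^sub>R b) *\<^sub>R (y - x)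
        = (1 - t) *\<^sub>R (x + a *\<^sub>R (y - x)) + t *\<^sub>R (x + b *\<^sub>R (y - x))"
      by (simp add: algebra_simps)
    then show "?\<phi> ((1 - t) *\<^sub>R a + t *\<^sub>R b) \<le> (1 - t) * ?\<phi> a + t * ?\<phi> b"
      using convex_onD[OF conv, of t "x + a *\<^sub>R (y - x)" "x + b *\<^sub>R (y - x)"] t by simp
  qed simp
  from convex_on_imp_above_tangent[OF this, of 0 1 "D \<bullet> (y - x)"]
  show ?thesis using DERIV_along_line[of h x 0 "y - x" D] grad by simp
qed

text \<open>A mean value argument takes the place of integration. The condition is required only
  between \<open>x\<close> and points of the open segment, as in the application it is known only on
  the domain.\<close>

lemma holder_descent:
  fixes h :: "'a::real_inner \<Rightarrow> real"
  assumes grad: "\<And>z. GDERIV h z :> dh z"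
    and nu: "0 < \<nu>" and M: "0 \<le> M"
    and holder: "\<And>\<tau>. 0 < \<tau> \<Longrightarrow> \<tau> < 1 \<Longrightarrow>
      norm (dh (x + \<tau> *\<^sub>R u) - dh x) \<le> M * norm (\<tau> *\<^sub>R u) powr \<nu>"
  shows "h (x + u) \<le> h x + dh x \<bullet> u + M / (1 + \<nu>) * norm u powr (1 + \<nu>)"
proof -
  define C where "C = M / (1 + \<nu>) * norm u powr (1 + \<nu>)"
  \<comment> \<open>The correction with \<open>C\<close> makes the claim equivalent to
    \<open>\<phi> 1 \<le> \<phi> 0\<close>; its derivative balances the Hoelder bound on the
    gradient change.\<close>
  define \<phi> where "\<phi> \<tau> = h (x + \<tau> *\<^sub>R u) - \<tau> * (dh x \<bullet> u) - C * \<tau> powr (1 + \<nu>)" for \<tau>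
  define \<phi>' where "\<phi>' \<tau> = dh (x + \<tau> *\<^sub>R u) \<bullet> u - dh x \<bullet> u - C * ((1 + \<nu>) * \<tau> powr \<nu>)" for \<tau>
  have line: "((\<lambda>\<tau>. h (x + \<tau> *\<^sub>R u)) has_real_derivative dh (x + \<tau> *\<^sub>R u) \<bullet> u) (at \<tau>)" for \<tau>
    by (rule DERIV_along_line[OF grad])
  have cont: "continuous_on {0..1} \<phi>"
    unfolding \<phi>_def using nu
    by (intro continuous_intros continuous_on_powr' DERIV_continuous_on[OF DERIV_subset[OF line]]) auto
  have "(\<phi> has_real_derivative \<phi>' \<tau>) (at \<tau>)" if "0 < \<tau>" for \<tau>
    unfolding \<phi>_def \<phi>'_def using that nu
    by (auto intro!: derivative_eq_intros line)
  then have deriv: "(\<phi> has_derivative (\<lambda>k. \<phi>' \<tau> * k)) (at \<tau>)" if "0 < \<tau>" for \<tau>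
    using that by (simp add: has_field_derivative_def)
  have "\<exists>\<xi>. 0 < \<xi> \<and> \<xi> < 1 \<and> \<phi> 1 - \<phi> 0 = \<phi>' \<xi> * (1 - 0)"
    by (rule mvt[OF zero_less_one cont, of "\<lambda>\<tau> k. \<phi>' \<tau> * k"]) (use deriv in \<open>blast+\<close>)
  then obtain \<xi> where \<xi>: "0 < \<xi>" "\<xi> < 1" "\<phi> 1 - \<phi> 0 = \<phi>' \<xi>"
    by auto
  have "(dh (x + \<xi> *\<^sub>R u) - dh x) \<bullet> u \<le> norm (dh (x + \<xi> *\<^sub>R u) - dh x) * norm u"
    by (rule norm_cauchy_schwarz)
  also have "\<dots> \<le> M * norm (\<xi> *\<^sub>R u) powr \<nu> * norm u"
    using holder[OF \<xi>(1,2)] by (intro mult_right_mono) auto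
  also have "\<dots> = C * ((1 + \<nu>) * \<xi> powr \<nu>)"
    using nu \<xi> by (cases "u = 0") (auto simp: C_def powr_mult powr_add)
  finally have "\<phi>' \<xi> \<le> 0" by (simp add: \<phi>'_def inner_diff_left)
  then show ?thesis using \<xi>(3) by (simp add: \<phi>_def C_def)
qed

section \<open>The composite problem and a single backtracking search\<close>

locale composite_problem =
  fixes g :: "'m::finite \<Rightarrow> 'a::real_inner \<Rightarrow> ereal"
    and h :: "'m \<Rightarrow> 'a \<Rightarrow> real"
    and dh :: "'m \<Rightarrow> 'a \<Rightarrow> 'a"
    and s :: "'a \<Rightarrow> 'a"
    and \<nu> M D :: real
  assumes g_proper: "\<And>i. proper_fun (g i)"
    and g_convex: "\<And>i. convex_fun (g i)"
    and h_grad: "\<And>i z. GDERIV (h i) z :> dh i z"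
    and nu: "0 < \<nu>" "\<nu> \<le> 1"
    and M_pos: "0 < M"
    and holder: "\<And>i y z. y \<in> dom_all g \<Longrightarrow> z \<in> dom_all g \<Longrightarrow>
                   norm (dh i y - dh i z) \<le> M * norm (y - z) powr \<nu>"
    and diam: "\<And>y z. y \<in> dom_all g \<Longrightarrow> z \<in> dom_all g \<Longrightarrow> norm (y - z) \<le> D"
    and s_dom: "\<And>z. z \<in> dom_all g \<Longrightarrow> s z \<in> dom_all g"
    and s_min: "\<And>z. z \<in> dom_all g \<Longrightarrow> is_arg_min (gap_obj g dh z) (\<lambda>_. True) (s z)"
begin

text \<open>Where \<open>g i\<close> is infinite, \<open>real_of_ereal\<close> returns 0, so
  \<open>gr\<close> and \<open>f\<close> represent the objective only on the domain.\<close>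

definition gr :: "'m \<Rightarrow> 'a \<Rightarrow> real" where
  "gr i y = real_of_ereal (g i y)"

definition f :: "'m \<Rightarrow> 'a \<Rightarrow> real" where
  "f i y = gr i y + h i y"

definition K :: real where
  "K = 2 * M * D powr (1 + \<nu>)"

lemma g_eq: "y \<in> dom_all g \<Longrightarrow> g i y = ereal (gr i y)"
  using g_proper[of i] unfolding gr_def
  by (cases "g i y") (auto simp: dom_all_def dom_fun_def proper_fun_def)

lemma composite_eq: "y \<in> dom_all g \<Longrightarrow> composite_obj g h i y = ereal (f i y)"
  by (simp add: composite_obj_def g_eq f_def)

lemma g_segment_le:
  assumes "y \<in> dom_all g" "z \<in> dom_all g" "0 \<le> t" "t \<le> 1"
  shows "g i (y + t *\<^sub>R (z - y)) \<le> ereal (gr i y + t * (gr i z - gr i y))"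
proof -
  have eq: "y + t *\<^sub>R (z - y) = (1 - t) *\<^sub>R y + t *\<^sub>R z"
    by (simp add: algebra_simps)
  have "g i ((1 - t) *\<^sub>R y + t *\<^sub>R z) \<le> ereal (1 - t) * g i y + ereal t * g i z"
    using g_convex[of i] assms unfolding convex_fun_def by auto
  then show ?thesis unfolding eq using assms by (simp add: g_eq algebra_simps)
qed

lemma segment_dom:
  assumes "y \<in> dom_all g" "z \<in> dom_all g" "0 \<le> t" "t \<le> 1"
  shows "y + t *\<^sub>R (z - y) \<in> dom_all g"
proof -
  have "g i (y + t *\<^sub>R (z - y)) < \<infinity>" for i
    by (rule le_less_trans[OF g_segment_le[OF assms]]) simp
  then show ?thesis by (simp add: dom_all_def dom_fun_def)
qed

lemma gap_obj_eq:
  assumes "y \<in> dom_all g" "u \<in> dom_all g"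
  shows "gap_obj g dh y u = ereal (Max (range (\<lambda>i. gr i u - gr i y + dh i y \<bullet> (u - y))))"
proof -
  have "mono ereal" by (auto intro: monoI)
  then show ?thesis
    using assms by (simp add: gap_obj_def g_eq mono_Max_commute image_comp comp_def)
qed

lemma gap_eq:
  assumes "y \<in> dom_all g"
  shows "gap g dh y = Max (range (\<lambda>i. gr i (s y) - gr i y + dh i y \<bullet> (s y - y)))"
proof -
  have "(INF u. gap_obj g dh y u) = gap_obj g dh y (s y)"
    using s_min[OF assms] by (intro antisym INF_lower INF_greatest) (auto simp: is_arg_min_def not_less)
  then show ?thesis by (simp add: gap_def gap_obj_eq[OF assms s_dom[OF assms]])
qed

lemma gap_le:
  assumes "y \<in> dom_all g" "u \<in> dom_all g"
  obtains i where "gap g dh y \<le> gr i u - gr i y + dh i y \<bullet> (u - y)"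
proof -
  have "gap_obj g dh y (s y) \<le> gap_obj g dh y u"
    using s_min[OF assms(1)] by (auto simp: is_arg_min_def not_less)
  then have "gap g dh y \<le> Max (range (\<lambda>i. gr i u - gr i y + dh i y \<bullet> (u - y)))"
    by (simp add: gap_obj_eq assms s_dom gap_eq)
  moreover have "Max (range (\<lambda>i. gr i u - gr i y + dh i y \<bullet> (u - y)))
      \<in> range (\<lambda>i. gr i u - gr i y + dh i y \<bullet> (u - y))"
    by (intro Max_in) auto
  then obtain i where "Max (range (\<lambda>i. gr i u - gr i y + dh i y \<bullet> (u - y)))
      = gr i u - gr i y + dh i y \<bullet> (u - y)"
    by blast
  ultimately show thesis using that by simp
qed

lemma gap_nonpos: "y \<in> dom_all g \<Longrightarrow> gap g dh y \<le> 0"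
  using gap_le[of y y] by force

lemma s_ne:
  assumes "y \<in> dom_all g" "gap g dh y \<noteq> 0"
  shows "s y \<noteq> y"
  using assms gap_eq[of y] by auto

text \<open>Convexity handles \<open>gr\<close>, the descent inequality handles \<open>h\<close>,
  and the sum of the two linear terms is one of the members of the maximum that defines the gap at
  \<open>s y\<close>.\<close>

lemma f_segment_le:
  assumes y: "y \<in> dom_all g" and t: "0 \<le> t" "t \<le> 1"
  shows "f i (y + t *\<^sub>R (s y - y))
    \<le> f i y + t * gap g dh y + M / (1 + \<nu>) * (t * norm (s y - y)) powr (1 + \<nu>)"
proof -
  note sy = s_dom[OF y]
  let ?u = "t *\<^sub>R (s y - y)"
  define p q where "p = dh i y \<bullet> (s y - y)" and "q = gr i (s y) - gr i y"
  have norm_u: "norm ?u = t * norm (s y - y)" using t by simp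
  have "gr i (y + ?u) \<le> gr i y + t * q"
    using g_segment_le[OF y sy t, of i] by (simp add: g_eq segment_dom y sy t q_def)
  moreover have "h i (y + ?u) \<le> h i y + dh i y \<bullet> ?u + M / (1 + \<nu>) * norm ?u powr (1 + \<nu>)"
  proof (rule holder_descent[OF h_grad])
    fix \<tau> :: real assume \<tau>: "0 < \<tau>" "\<tau> < 1"
    have "y + (\<tau> * t) *\<^sub>R (s y - y) \<in> dom_all g"
      using \<tau> t by (intro segment_dom y sy) (auto simp: mult_le_one)
    from holder[OF this y] show "norm (dh i (y + \<tau> *\<^sub>R ?u) - dh i y) \<le> M * norm (\<tau> *\<^sub>R ?u) powr \<nu>"
      by simp
  qed (use nu M_pos in auto)
  then have "h i (y + ?u) \<le> h i y + t * p + M / (1 + \<nu>) * (t * norm (s y - y)) powr (1 + \<nu>)"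
    unfolding norm_u p_def by simp
  moreover have "q + p \<le> gap g dh y"
    unfolding gap_eq[OF y] p_def q_def by (intro Max_ge) auto
  then have "t * q + t * p \<le> t * gap g dh y"
    using t by (simp add: mult_left_mono flip: distrib_left)
  ultimately show ?thesis unfolding f_def by linarith
qed

lemma trial_step_bounds:
  assumes "0 < L" shows "0 \<le> trial_step g dh s y L" "trial_step g dh s y L \<le> 1"
  using assms by (auto simp: trial_step_def)

lemma trial_point_dom:
  assumes "y \<in> dom_all g" "0 < L"
  shows "trial_point g dh s y L \<in> dom_all g"
  unfolding trial_point_def using assms by (intro segment_dom s_dom trial_step_bounds) auto

lemma trial_accepted_iff:
  assumes "y \<in> dom_all g" "0 < L"
  shows "trial_accepted g h dh s y L \<longleftrightarrow> (\<forall>i. f i (trial_point g dh s y L) \<le> f i y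
     - trial_step g dh s y L * \<bar>gap g dh y\<bar> / 2 + L * (trial_step g dh s y L * norm (s y - y))\<^sup>2 / 2)"
  using assms
  by (simp add: trial_accepted_def Let_def composite_eq trial_point_dom power_mult_distrib mult.assoc
      add_diff_eq diff_add_eq)

lemma trial_rejected_bound:
  assumes y: "y \<in> dom_all g" and gap: "gap g dh y \<noteq> 0" and L: "0 < L"
    and rej: "\<not> trial_accepted g h dh s y L" and w: "0 < w" "w \<le> \<bar>gap g dh y\<bar>"
  shows "min 1 ((w / K) powr (1 / \<nu>)) * (4 * L * D\<^sup>2) \<le> w"
proof -
  let ?t = "trial_step g dh s y L" and ?d = "norm (s y - y)" and ?v = "\<bar>gap g dh y\<bar>"
  have d: "0 < ?d" "?d \<le> D" using s_ne[OF y gap] diam[OF s_dom[OF y] y] by auto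
  obtain i where "f i y - ?t * ?v / 2 + L * (?t * ?d)\<^sup>2 / 2 < f i (trial_point g dh s y L)"
    using rej unfolding trial_accepted_iff[OF y L] by (auto simp: not_le)
  also have "\<dots> \<le> f i y + ?t * gap g dh y + M / (1 + \<nu>) * (?t * ?d) powr (1 + \<nu>)"
    unfolding trial_point_def using trial_step_bounds[OF L] by (intro f_segment_le y) auto
  \<comment> \<open>The acceptance test asks for half of this first-order decrease; the other half
    stays on the left below.\<close>
  also have "?t * gap g dh y = - (?t * ?v)" using gap_nonpos[OF y] by simp
  finally have "?t * ?v / 2 + L * (?t * ?d)\<^sup>2 / 2 < M / (1 + \<nu>) * (?t * ?d) powr (1 + \<nu>)"
    by simp
  from rejected_const_bound[OF nu M_pos w(1) d(1) L w(2) d(2) _ this]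
  have "min 1 ((w / K) powr (1 / \<nu>)) \<le> w / (4 * L * D\<^sup>2)"
    by (simp add: trial_step_def K_def)
  moreover have "0 < D" using d by linarith
  then have "0 < 4 * L * D\<^sup>2" using L by simp
  ultimately show ?thesis by (simp only: pos_le_divide_eq)
qed

text \<open>Rejections keep the trial constant bounded (take \<open>w\<close> to be the gap itself),
  while it doubles with \<open>l\<close>. Hence the \<open>LEAST\<close> in the algorithm is
  attained.\<close>

lemma ex_trial_accepted:
  assumes y: "y \<in> dom_all g" and gap: "gap g dh y \<noteq> 0" and L: "0 < L"
  shows "\<exists>l. trial_accepted g h dh s y (trial_const L l)"
proof (rule ccontr)
  assume "\<not> ?thesis"
  then have rej: "\<not> trial_accepted g h dh s y (trial_const L l)" for l by auto
  have D: "0 < D" using s_ne[OF y gap] diam[OF s_dom[OF y] y] by (smt (verit) zero_less_norm_iff right_minus_eq)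
  let ?v = "\<bar>gap g dh y\<bar>"
  define c where "c = min 1 ((?v / K) powr (1 / \<nu>)) * (4 * (L / 2) * D\<^sup>2)"
  have "0 < K" using D M_pos by (simp add: K_def)
  then have c: "0 < c" using gap L D by (simp add: c_def)
  have "c * 2 ^ l \<le> ?v" for l
  proof -
    have tc: "trial_const L l = 2 ^ l * (L / 2)"
      by (simp add: trial_const_def power_int_diff)
    have "0 < trial_const L l" using L by (simp add: tc)
    from trial_rejected_bound[OF y gap this rej, of ?v] gap
    show ?thesis by (simp add: tc c_def mult_ac)
  qed
  moreover obtain l where "?v / c < 2 ^ l" using real_arch_pow[of 2 "?v / c"] by auto
  ultimately show False using c by (simp add: field_simps) (meson not_le)
qed

end

section \<open>The generated sequence\<close>

locale condg_run = composite_problem g h dh s \<nu> M D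
  for g :: "'m::finite \<Rightarrow> 'a::real_inner \<Rightarrow> ereal"
    and h :: "'m \<Rightarrow> 'a \<Rightarrow> real"
    and dh :: "'m \<Rightarrow> 'a \<Rightarrow> 'a"
    and s :: "'a \<Rightarrow> 'a"
    and \<nu> M D :: real +
  fixes x0 :: 'a and Linit :: real and x :: "nat \<Rightarrow> 'a"
  assumes x0_dom: "x0 \<in> dom_all g"
    and Linit_pos: "0 < Linit"
    and x_eq: "x = condg_iterate g h dh s x0 Linit"
    and x_infinite: "\<And>k. gap g dh (x k) \<noteq> 0"
begin

text \<open>Indices are shifted by one: \<open>Lprev (Suc k)\<close> is the constant accepted in
  iteration \<open>k\<close>, and \<open>Lprev 0\<close> is \<open>Linit\<close>.\<close>

definition Lprev :: "nat \<Rightarrow> real" where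
  "Lprev k = snd (condg_state g h dh s x0 Linit k)"

definition v :: "nat \<Rightarrow> real" where
  "v k = \<bar>gap g dh (x k)\<bar>"

text \<open>Membership and positivity hold for whatever index \<open>LEAST\<close> returns, so they
  come first and then yield an accepted index. The last claim splits on whether the first trial
  passed; otherwise, by minimality, half of the accepted constant was rejected.\<close>

lemma run_invariant: "x k \<in> dom_all g \<and> 0 < Lprev k"
  and run_step: "x (Suc k) = trial_point g dh s (x k) (Lprev (Suc k))"
    "trial_accepted g h dh s (x k) (Lprev (Suc k))"
    "Lprev (Suc k) = Lprev k / 2 \<or> \<not> trial_accepted g h dh s (x k) (Lprev (Suc k) / 2)"
proof -
  define l where "l k = (LEAST l. trial_accepted g h dh s (x k) (trial_const (Lprev k) l))" for k
  have L: "Lprev (Suc k) = trial_const (Lprev k) (l k)" for k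
    by (simp add: Lprev_def l_def x_eq condg_iterate_def Let_def)
  have X: "x (Suc k) = trial_point g dh s (x k) (Lprev (Suc k))" for k
    by (simp add: Lprev_def x_eq condg_iterate_def Let_def)
  have inv: "x k \<in> dom_all g \<and> 0 < Lprev k" for k
  proof (induction k)
    case 0
    then show ?case by (simp add: x_eq condg_iterate_def Lprev_def x0_dom Linit_pos)
  next
    case (Suc k)
    have "0 < Lprev (Suc k)" using Suc by (simp add: L trial_const_def)
    then show ?case using Suc by (simp add: X trial_point_dom)
  qed
  show "x k \<in> dom_all g \<and> 0 < Lprev k" by (rule inv)
  show "x (Suc k) = trial_point g dh s (x k) (Lprev (Suc k))" by (rule X)
  have ex: "\<exists>l. trial_accepted g h dh s (x k) (trial_const (Lprev k) l)"
    using inv[of k] x_infinite by (intro ex_trial_accepted) auto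
  show "trial_accepted g h dh s (x k) (Lprev (Suc k))"
    unfolding L l_def by (rule LeastI_ex[OF ex])
  show "Lprev (Suc k) = Lprev k / 2 \<or> \<not> trial_accepted g h dh s (x k) (Lprev (Suc k) / 2)"
  proof (cases "l k")
    case 0
    then show ?thesis by (simp add: L trial_const_def)
  next
    case (Suc l')
    then have "\<not> trial_accepted g h dh s (x k) (trial_const (Lprev k) l')"
      unfolding l_def by (intro not_less_Least) auto
    moreover have "trial_const (Lprev k) l' = Lprev (Suc k) / 2"
      by (simp add: L Suc trial_const_def power_int_diff)
    ultimately show ?thesis by simp
  qed
qed

lemma x_dom: "x k \<in> dom_all g" and Lprev_pos: "0 < Lprev k"
  using run_invariant by auto

lemma v_pos: "0 < v k"
  using x_infinite by (simp add: v_def)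

lemma step_norm: "0 < norm (s (x k) - x k)" "norm (s (x k) - x k) \<le> D"
  using s_ne[OF x_dom x_infinite] diam[OF s_dom[OF x_dom] x_dom] by auto

lemma D_pos: "0 < D"
  using step_norm[of 0] by linarith

text \<open>Halving preserves either alternative, and a rejection establishes the second. As
  \<open>w\<close> lies below all earlier gaps, a bound from an old rejection stays valid with the
  same \<open>w\<close>.\<close>

lemma Lprev_bound:
  assumes "0 < w" "\<And>j. j < k \<Longrightarrow> w \<le> v j"
  shows "Lprev k \<le> Linit / 2 ^ k \<or> min 1 ((w / K) powr (1 / \<nu>)) * (2 * Lprev k * D\<^sup>2) \<le> w"
  using assms(2)
proof (induction k)
  case 0
  show ?case by (simp add: Lprev_def)
next
  case (Suc k)
  let ?m = "min 1 ((w / K) powr (1 / \<nu>))"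
  from run_step(3)[of k] show ?case
  proof
    assume half: "Lprev (Suc k) = Lprev k / 2"
    from Suc have "Lprev k \<le> Linit / 2 ^ k \<or> ?m * (2 * Lprev k * D\<^sup>2) \<le> w" by simp
    then show ?thesis
    proof
      assume "?m * (2 * Lprev k * D\<^sup>2) \<le> w"
      moreover have "?m * (2 * Lprev (Suc k) * D\<^sup>2) \<le> ?m * (2 * Lprev k * D\<^sup>2)"
        using Lprev_pos[of k] by (intro mult_left_mono mult_right_mono) (auto simp: half)
      ultimately show ?thesis by linarith
    qed (simp add: half)
  next
    assume "\<not> trial_accepted g h dh s (x k) (Lprev (Suc k) / 2)"
    from trial_rejected_bound[OF x_dom x_infinite _ this, of w] Lprev_pos[of "Suc k"] assms(1) Suc.prems[of k]
    show ?thesis by (simp add: v_def)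
  qed
qed

lemma Lprev_bound_late:
  assumes w: "0 < w" "\<And>j. j \<le> k \<Longrightarrow> w \<le> v j"
    and k: "nat \<lceil>max 0 (log 2 (Linit / L_tilde g dh s \<nu> M (x 0)))\<rceil> \<le> k"
  shows "min 1 ((w / K) powr (1 / \<nu>)) * (2 * Lprev (Suc k) * D\<^sup>2) \<le> w"
proof -
  let ?m = "min 1 ((w / K) powr (1 / \<nu>))" and ?Lt = "L_tilde g dh s \<nu> M (x 0)"
  have "0 < holder_L \<nu> M (v 0 / 2)"
    using nu M_pos v_pos[of 0] by (intro holder_L_pos) auto
  then have Lt: "0 < ?Lt" by (simp add: L_tilde_def v_def less_max_iff_disj)
  have "log 2 (Linit / ?Lt) \<le> real k" using k by linarith
  then have "Linit / ?Lt \<le> 2 powr real k"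
    using Lt Linit_pos by (simp add: log_le_iff)
  then have "Linit \<le> 2 ^ k * ?Lt" using Lt by (simp add: powr_realpow pos_divide_le_eq)
  \<comment> \<open>Iteration \<open>k\<close> itself contributes one more halving, which yields the
    half needed for \<open>L_tilde_bound\<close>.\<close>
  then have "Linit / 2 ^ Suc k \<le> ?Lt / 2" by (simp add: field_simps)
  moreover have "Lprev (Suc k) \<le> Linit / 2 ^ Suc k \<or> ?m * (2 * Lprev (Suc k) * D\<^sup>2) \<le> w"
    by (rule Lprev_bound) (use w in auto)
  moreover have "?m * (2 * Lprev (Suc k) * D\<^sup>2) \<le> w" if "Lprev (Suc k) \<le> ?Lt / 2"
  proof -
    have "?m * (2 * Lprev (Suc k) * D\<^sup>2) \<le> ?m * (D\<^sup>2 * ?Lt)"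
      using mult_right_mono[of "2 * Lprev (Suc k)" ?Lt "D\<^sup>2"] that
      by (intro mult_left_mono) (simp_all add: mult.commute)
    also have "\<dots> \<le> w"
      unfolding L_tilde_def K_def
      using L_tilde_bound[OF nu M_pos w(1) step_norm(1)[of 0] w(2)[of 0] step_norm(2)[of 0]]
      by (simp add: v_def)
    finally show ?thesis .
  qed
  ultimately show ?thesis by linarith
qed

lemma trial_step_lower:
  assumes w: "0 < w" "\<And>j. j \<le> k \<Longrightarrow> w \<le> v j"
    and k: "nat \<lceil>max 0 (log 2 (Linit / L_tilde g dh s \<nu> M (x 0)))\<rceil> \<le> k"
  shows "min 1 ((w / K) powr (1 / \<nu>)) \<le> trial_step g dh s (x k) (Lprev (Suc k))"
proof -
  let ?m = "min 1 ((w / K) powr (1 / \<nu>))" and ?L = "Lprev (Suc k)" and ?d = "norm (s (x k) - x k)"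
  have "?m \<le> w / (2 * ?L * D\<^sup>2)"
    using Lprev_bound_late[OF w k] D_pos Lprev_pos[of "Suc k"] by (simp add: pos_le_divide_eq)
  also have "\<dots> \<le> v k / (2 * ?L * ?d\<^sup>2)"
    using w(1) w(2)[of k] Lprev_pos[of "Suc k"] step_norm[of k]
    by (intro frac_le mult_left_mono power_mono mult_pos_pos zero_less_power) auto
  finally show ?thesis by (simp add: trial_step_def v_def)
qed

text \<open>The cap on the step length bounds the quadratic term of the acceptance test by half of
  its linear term.\<close>

lemma f_decrease:
  "f i (x (Suc k)) \<le> f i (x k) - trial_step g dh s (x k) (Lprev (Suc k)) * v k / 4"
proof -
  let ?L = "Lprev (Suc k)" and ?d = "norm (s (x k) - x k)"
  let ?t = "trial_step g dh s (x k) ?L"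
  have t: "0 \<le> ?t" by (rule trial_step_bounds[OF Lprev_pos])
  have L: "0 < ?L" by (rule Lprev_pos)
  have "f i (x (Suc k)) \<le> f i (x k) - ?t * v k / 2 + ?L * (?t * ?d)\<^sup>2 / 2"
    using run_step(2)[of k] unfolding trial_accepted_iff[OF x_dom L] run_step(1)[of k] v_def by blast
  moreover have "?t * (2 * ?L * ?d\<^sup>2) \<le> v k"
  proof -
    have "?t \<le> v k / (2 * ?L * ?d\<^sup>2)" by (simp add: trial_step_def v_def)
    then show ?thesis using L step_norm[of k] by (simp add: pos_le_divide_eq)
  qed
  then have "?t * (?t * (2 * ?L * ?d\<^sup>2)) \<le> ?t * v k" using t by (rule mult_left_mono)
  then have "?L * (?t * ?d)\<^sup>2 / 2 \<le> ?t * v k / 4" by (simp add: power2_eq_square mult_ac)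
  ultimately show ?thesis by linarith
qed

lemma min_excess_eq:
  assumes "xs \<in> dom_all g" "y \<in> dom_all g"
  shows "min_excess g h xs y = Min (range (\<lambda>i. f i y - f i xs))"
proof -
  have "mono ereal" by (auto intro: monoI)
  then have "Min (range (\<lambda>i. composite_obj g h i y - composite_obj g h i xs))
      = ereal (Min (range (\<lambda>i. f i y - f i xs)))"
    using assms by (simp add: composite_eq mono_Min_commute image_comp comp_def)
  then show ?thesis by (simp add: min_excess_def)
qed

text \<open>All components decrease by the same amount, so it suffices to follow the index that
  attains the minimum at \<open>x k\<close>.\<close>

lemma min_excess_step:
  assumes xs: "xs \<in> dom_all g"
  shows "min_excess g h xs (x (Suc k))
    \<le> min_excess g h xs (x k) - trial_step g dh s (x k) (Lprev (Suc k)) * v k / 4"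
proof -
  have "Min (range (\<lambda>i. f i (x k) - f i xs)) \<in> range (\<lambda>i. f i (x k) - f i xs)"
    by (intro Min_in) auto
  then obtain i where i: "Min (range (\<lambda>i. f i (x k) - f i xs)) = f i (x k) - f i xs"
    by blast
  have "Min (range (\<lambda>i. f i (x (Suc k)) - f i xs)) \<le> f i (x (Suc k)) - f i xs"
    by (intro Min_le) auto
  with i f_decrease[of i k] show ?thesis unfolding min_excess_eq[OF xs x_dom] by linarith
qed

text \<open>The gap model is tested at \<open>xs\<close>; convexity of \<open>h i\<close> bounds its
  linear part by the true difference.\<close>

lemma min_excess_le_gap:
  assumes xs: "xs \<in> dom_all g" and conv: "\<And>i. convex_on UNIV (h i)"
  shows "min_excess g h xs (x k) \<le> v k"
proof -
  obtain i where "gap g dh (x k) \<le> gr i xs - gr i (x k) + dh i (x k) \<bullet> (xs - x k)"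
    using gap_le[OF x_dom xs] by blast
  moreover have "h i (x k) + dh i (x k) \<bullet> (xs - x k) \<le> h i xs"
    by (rule convex_gradient_inequality[OF conv h_grad])
  ultimately have "f i (x k) - f i xs \<le> v k"
    using gap_nonpos[OF x_dom[of k]] by (simp add: f_def v_def)
  moreover have "Min (range (\<lambda>i. f i (x k) - f i xs)) \<le> f i (x k) - f i xs"
    by (intro Min_le) auto
  ultimately show ?thesis unfolding min_excess_eq[OF xs x_dom] by linarith
qed

lemma trial_step_pos: "0 < trial_step g dh s (x k) (Lprev (Suc k))"
  using v_pos[of k] Lprev_pos[of "Suc k"] step_norm[of k]
  by (simp add: trial_step_def v_def zero_less_divide_iff)

text \<open>Strictness comes from the next iterate: its excess is nonnegative and strictly smaller.
  Positivity is what makes the negative powers of the excess meaningful.\<close>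

lemma min_excess_pos:
  assumes xs: "xs \<in> dom_all g" and le: "\<And>i k. composite_obj g h i xs \<le> composite_obj g h i (x k)"
  shows "0 < min_excess g h xs (x k)"
proof -
  have "0 \<le> min_excess g h xs (x (Suc k))"
    using le by (simp add: min_excess_eq xs x_dom composite_eq)
  also have "\<dots> < min_excess g h xs (x k)"
    using min_excess_step[OF xs, of k] trial_step_pos[of k] v_pos[of k]
    by (smt (verit) mult_pos_pos divide_pos_pos)
  finally show ?thesis .
qed

end

section \<open>Transfer of the scalar rate to the algorithm\<close>

theorem theorem4p7:
  fixes g :: "'m::finite \<Rightarrow> real ^ 'n \<Rightarrow> ereal"
    and h :: "'m \<Rightarrow> real ^ 'n \<Rightarrow> real"
    and dh :: "'m \<Rightarrow> real ^ 'n \<Rightarrow> real ^ 'n"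
    and s :: "real ^ 'n \<Rightarrow> real ^ 'n"
    and x0 xstar :: "real ^ 'n"
    and x :: "nat \<Rightarrow> real ^ 'n"
    and Mi :: "'m \<Rightarrow> real"
    and \<nu> M D Linit A :: real
    and kt0 k0 :: nat
    and \<delta> \<Gamma> :: "nat \<Rightarrow> real"
  assumes g_proper: "\<And>i. proper_fun (g i)"
    and g_convex: "\<And>i. convex_fun (g i)"
    and g_lsc: "\<And>i. lsc_fun (g i)"
    and h_grad: "\<And>i z. GDERIV (h i) z :> dh i z"
    and h_C1: "\<And>i. continuous_on UNIV (dh i)"
    and dom_nonempty: "dom_all g \<noteq> {}"
    and dom_convex: "convex (dom_all g)"
    and dom_compact: "compact (dom_all g)"
    and D_eq: "D = diameter (dom_all g)"
    and nu: "0 < \<nu>" "\<nu> \<le> 1"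
    and Mi_pos: "\<And>i. Mi i > 0"
    and holder: "\<And>i y z. y \<in> dom_fun (g i) \<Longrightarrow> z \<in> dom_fun (g i) \<Longrightarrow>
                   norm (dh i y - dh i z) \<le> Mi i * norm (y - z) powr \<nu>"
    and M_eq: "M = Max (range Mi)"
    and s_dom: "\<And>z. z \<in> dom_all g \<Longrightarrow> s z \<in> dom_all g"
    and s_min: "\<And>z. z \<in> dom_all g \<Longrightarrow> is_arg_min (gap_obj g dh z) (\<lambda>_. True) (s z)"
    and x0_dom: "x0 \<in> dom_all g"
    and Linit_pos: "Linit > 0"
    and x_eq: "x = condg_iterate g h dh s x0 Linit"
    and x_infinite: "\<And>k. gap g dh (x k) \<noteq> 0"
    and h_convex: "\<And>i. convex_on UNIV (h i)"
    and xstar_dom: "xstar \<in> dom_all g"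
    and xstar_le: "\<And>i k. composite_obj g h i xstar \<le> composite_obj g h i (x k)"
    and \<delta>_eq: "\<And>k. \<delta> k = min_excess g h xstar (x k)"
    and A_eq: "A = (2 * M) powr (1 / \<nu>) * D powr ((1 + \<nu>) / \<nu>)"
    and kt0_eq: "kt0 = nat \<lceil>max 0 (log 2 (Linit / L_tilde g dh s \<nu> M (x 0)))\<rceil>"
    and k0_eq: "k0 = nat \<lceil>4 * max 0 (ln (4 * \<delta> kt0 / A powr \<nu>))\<rceil>"
    and \<Gamma>_eq: "\<And>k. \<Gamma> k = (\<delta> (k0 + kt0) powr (- (1 / \<nu>))
                          + (real k - real k0) / (4 * A * \<nu>)) powr (- \<nu>)"
  shows "(\<forall>k \<ge> k0 + kt0. \<delta> k \<le> \<Gamma> (k - kt0)) \<and>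
         (\<forall>k. real k \<ge> real k0 + real kt0 + 8 * A / \<delta> (k0 + kt0) powr (1 / \<nu>) \<longrightarrow>
            Min ((\<lambda>j. \<bar>gap g dh (x j)\<bar>) ` {0..k})
              \<le> exp (1 / exp 1) * \<Gamma> (nat \<lfloor>(real k - real kt0 + real k0 + 1) / 2\<rfloor>))"
proof -
  have Mi_le: "Mi i \<le> M" for i unfolding M_eq by (intro Max_ge) auto
  \<comment> \<open>\<open>undefined\<close> serves as an arbitrary index, since every type is
    inhabited.\<close>
  have M_pos: "0 < M" using Mi_pos[of undefined] Mi_le[of undefined] by linarith
  interpret condg_run g h dh s \<nu> M D x0 Linit x
  proof
    fix i y z assume yz: "y \<in> dom_all g" "z \<in> dom_all g"
    have "norm (dh i y - dh i z) \<le> Mi i * norm (y - z) powr \<nu>"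
      using yz by (intro holder) (auto simp: dom_all_def)
    also have "\<dots> \<le> M * norm (y - z) powr \<nu>"
      by (intro mult_right_mono Mi_le) auto
    finally show "norm (dh i y - dh i z) \<le> M * norm (y - z) powr \<nu>" .
  next
    fix y z assume "y \<in> dom_all g" "z \<in> dom_all g"
    then show "norm (y - z) \<le> D"
      unfolding D_eq using diameter_bounded_bound[OF compact_imp_bounded[OF dom_compact]]
      by (simp add: dist_norm)
  qed (fact g_proper g_convex h_grad nu M_pos s_dom s_min x0_dom Linit_pos x_eq x_infinite)+
  have K_pos: "0 < K" using M_pos D_pos by (simp add: K_def)
  \<comment> \<open>Thus \<open>(w / K) powr (1 / \<nu>)\<close> is
    \<open>w powr (1 / \<nu>) / A\<close>, the form used in the scalar recursion.\<close>
  have A_K: "A = K powr (1 / \<nu>)"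
  proof -
    have "(1 + \<nu>) / \<nu> = (1 + \<nu>) * (1 / \<nu>)" by simp
    then show ?thesis unfolding A_eq K_def powr_mult powr_powr by simp
  qed
  have A_pos: "0 < A" using K_pos by (simp add: A_K)
  have \<delta>_pos: "0 < \<delta> k" for k
    unfolding \<delta>_eq by (rule min_excess_pos[OF xstar_dom xstar_le])
  have \<delta>_le: "\<delta> k \<le> v k" for k
    unfolding \<delta>_eq by (rule min_excess_le_gap[OF xstar_dom h_convex])
  have step: "\<delta> (Suc k) \<le> \<delta> k - trial_step g dh s (x k) (Lprev (Suc k)) * v k / 4" for k
    unfolding \<delta>_eq by (rule min_excess_step[OF xstar_dom])
  have \<delta>_dec: "\<delta> (Suc k) \<le> \<delta> k" for k
    using step[of k] mult_pos_pos[OF trial_step_pos[of k] v_pos[of k]] by linarith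
  have \<delta>_step: "\<delta> (Suc k) \<le> \<delta> k - w / 4 * min 1 (w powr (1 / \<nu>) / A)"
    if k: "kt0 \<le> k" and w: "0 < w" "\<And>j. j \<le> k \<Longrightarrow> w \<le> v j" for k w
  proof -
    have "w * min 1 ((w / K) powr (1 / \<nu>)) \<le> v k * trial_step g dh s (x k) (Lprev (Suc k))"
      using w(1) w(2)[of k] trial_step_lower[OF w k[unfolded kt0_eq]] by (intro mult_mono) auto
    then show ?thesis using step[of k] by (simp add: A_K powr_divide mult.commute)
  qed
  from sublinear_decrease[OF nu(1) A_pos \<delta>_pos \<delta>_dec \<delta>_le \<delta>_step k0_eq \<Gamma>_eq]
  show ?thesis unfolding v_def by blast
qed

end
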